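(* Let $n\ge 3$ be an odd integer, let $C$ be the $n\times n$ matrix $C=\left[\cos\left(\frac{(i-j)\pi}{n}\right)\right]_{i,j=1}^n$, and let $r$ be a nonnegative real number. Then the matrix $|C|_\circ^{\circ r}=\left[\left|\cos\left(\frac{(i-j)\pi}{n}\right)\right|^r\right]_{i,j=1}^n$ is positive semidefinite if and only if $r$ is a nonnegative even integer or $r>n-3$.
   Context: For a real matrix $A=[a_{ij}]$ and a real number $r$, $|A|_\circ^{\circ r}$ denotes the matrix $[|a_{ij}|^r]$. (Since $n$ is odd, no entry of $C$ is zero.) *)

theory Defs
  imports Complex_Main "Jordan_Normal_Form.Matrix"
begin

definition positive_semidefinite :: "real mat \<Rightarrow> bool" where
  "positive_semidefinite A \<longleftrightarrow>
     A\<^sup>T = A \<and> (\<forall>v \<in> carrier_vec (dim_row A). 0 \<le> v \<bullet> (A *\<^sub>v v))"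

(* Since 0 powr 0 = 0, a zero entry stays zero for r = 0. *)
definition hadamard_abs_power :: "real mat \<Rightarrow> real \<Rightarrow> real mat" where
  "hadamard_abs_power A r = map_mat (\<lambda>a. \<bar>a\<bar> powr r) A"

(* Indices run over 0, ..., n - 1 instead of 1, ..., n; entries depend only on i - j. *)
definition cos_matrix :: "nat \<Rightarrow> real mat" where
  "cos_matrix n = mat n n (\<lambda>(i, j). cos ((real i - real j) * pi / real n))"

end

theory Submission
  imports Defs
begin

text \<open>The matrix is circulant, so it is positive semidefinite iff all its eigenvalues
  \<open>F\<^sub>m(r) = (\<Sum>k<n. \<bar>cos (k\<pi>/n)\<bar> powr r * cos (2\<pi>mk/n))\<close> are nonnegative; by symmetry only
  \<open>2m < n\<close> matters. As a function of \<open>r\<close>, \<open>F\<^sub>m\<close> is a real exponential sum whose coefficients,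
  ordered by the size of the base, have \<open>m\<close> sign changes. By Descartes' rule of signs it has at most
  \<open>m\<close> real zeros, counted with multiplicity. The recursion \<open>cos\<^sup>2 \<theta> = (1 + cos 2\<theta>)/2\<close> shows that
  \<open>0, 2, \<dots>, 2(m - 1)\<close> are zeros, so they are all of them and they are simple. Since
  \<open>F\<^sub>m(r) \<longlongrightarrow> 1\<close>, the sign of \<open>F\<^sub>m\<close> is positive beyond \<open>2(m - 1)\<close> and negative between
  \<open>2(m - 2)\<close> and \<open>2(m - 1)\<close>; for \<open>m = 2, \<dots>, (n - 1)/2\<close> these intervals exhaust the
  non-even \<open>r < n - 3\<close>.\<close>

section \<open>Circulant quadratic forms and the discrete cosine transform\<close>

text \<open>For even \<open>n\<close>-periodic \<open>w\<close> this is the discrete Fourier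
  transform. Integer frequencies make \<open>m - 1\<close> and \<open>- m\<close> available without
  truncation.\<close>

definition cos_transform :: "nat \<Rightarrow> (int \<Rightarrow> real) \<Rightarrow> int \<Rightarrow> real" where
  "cos_transform n w m = (\<Sum>k<n. w (int k) * cos (2 * pi * m * k / n))"

lemma sum_periodic_shift:
  fixes h :: "int \<Rightarrow> real"
  assumes per: "\<And>k. h (k + int n) = h k"
  shows "(\<Sum>k<n. h (int k + c)) = (\<Sum>k<n. h (int k))"
proof -
  have step: "(\<Sum>k<n. h (int k + (c + 1))) = (\<Sum>k<n. h (int k + c))" for c
  proof -
    have "(\<Sum>k<Suc n. h (int k + c)) = h c + (\<Sum>k<n. h (int k + (c + 1)))"
      by (subst sum.lessThan_Suc_shift) (simp add: algebra_simps)
    moreover have "(\<Sum>k<Suc n. h (int k + c)) = (\<Sum>k<n. h (int k + c)) + h c"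
      using per[of c] by (simp add: algebra_simps)
    ultimately show ?thesis by simp
  qed
  show ?thesis
  proof (induction c rule: int_induct[where k = 0])
    case (step2 i)
    then show ?case using step[of "i - 1"] by simp
  qed (use step in simp_all)
qed

text \<open>Real part of a geometric series in an \<open>n\<close>-th root of unity, which vanishes
  unless the root is 1.\<close>

lemma sum_cos_multiples:
  fixes d :: int
  assumes "0 < n"
  shows "(\<Sum>k<n. cos (2 * pi * d * real k / n)) = (if int n dvd d then real n else 0)"
proof (cases "int n dvd d")
  case True
  then obtain e where e: "d = int n * e" by blast
  have "cos (2 * pi * d * real k / n) = 1" for k
  proof -
    have "2 * pi * d * real k / n = 2 * pi * of_int (e * int k)"
      using assms by (simp add: e)
    then show ?thesis by (simp only: cos_int_2pin)
  qed
  with True show ?thesis by simp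
next
  case False
  define z where "z = cis (2 * pi * d / n)"
  have "z ^ n = 1"
  proof -
    have "z ^ n = cis (2 * pi * of_int d)"
      using assms by (simp add: z_def DeMoivre)
    also have "\<dots> = 1"
      by (simp add: complex_eq_iff cos_int_2pin sin_int_2pin)
    finally show ?thesis .
  qed
  moreover have "z \<noteq> 1"
  proof
    assume "z = 1"
    then have "cos (2 * pi * d / n) = 1"
      by (simp add: z_def complex_eq_iff)
    then obtain x :: int where "2 * pi * d / n = x * 2 * pi"
      by (auto simp: cos_one_2pi_int)
    then have "real_of_int d = real_of_int (x * int n)"
      using assms by (simp add: field_simps)
    then have "d = x * int n" by (simp only: of_int_eq_iff)
    with False show False by simp
  qed
  ultimately have "(\<Sum>k<n. z ^ k) = 0"
    by (simp add: geometric_sum)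
  moreover have "Re (\<Sum>k<n. z ^ k) = (\<Sum>k<n. cos (2 * pi * d * real k / n))"
    by (simp add: z_def DeMoivre mult_ac)
  ultimately show ?thesis using False by simp
qed

text \<open>Fourier inversion. Product-to-sum formulas turn the left side into convolutions of
  \<open>w\<close> with the kernel \<open>D\<close>, which is \<open>n\<close> on multiples of
  \<open>n\<close> and 0 elsewhere. They yield \<open>w d\<close> and \<open>w (- d)\<close>, equal
  by evenness.\<close>

lemma cos_transform_inversion:
  fixes w :: "int \<Rightarrow> real"
  assumes n: "0 < n" and per: "\<And>k. w (k + int n) = w k" and even: "\<And>k. w (- k) = w k"
  shows "(\<Sum>m<n. cos_transform n w (int m) * cos (2 * pi * d * real m / n)) = real n * w d"
proof -
  define D where "D = (\<lambda>e. \<Sum>m<n. cos (2 * pi * of_int e * real m / n))"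
  have D: "D e = (if int n dvd e then real n else 0)" for e
    unfolding D_def using n by (rule sum_cos_multiples)
  have Dper: "D (k + int n + e) = D (k + e)" for k e
    using dvd_add_triv_right_iff[of "int n" "k + e"] by (simp add: D algebra_simps)
  have conv: "(\<Sum>k<n. w (int k) * D (int k + e)) = real n * w (- e)" for e
  proof -
    have "(\<Sum>k<n. w (int k) * D (int k + e)) = (\<Sum>k<n. w (int k - e) * D (int k))"
      using sum_periodic_shift[of "\<lambda>k. w k * D (k + e)" n "- e"] per Dper
      by simp
    also have "\<dots> = (\<Sum>k<n. if k = 0 then real n * w (- e) else 0)"
      by (intro sum.cong refl) (auto simp: D zdvd_not_zless dest: dvd_imp_le)
    finally show ?thesis using n by simp
  qed
  have "(\<Sum>m<n. cos_transform n w (int m) * cos (2 * pi * d * real m / n))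
      = (\<Sum>m<n. \<Sum>k<n. w (int k) * (cos (2 * pi * of_int (int k + - d) * real m / n)
          + cos (2 * pi * of_int (int k + d) * real m / n)) / 2)"
    unfolding cos_transform_def sum_distrib_right
  proof (intro sum.cong refl)
    fix m k :: nat
    have angles: "2 * pi * of_int (int k + - d) * real m / n = 2 * pi * (int m) * k / n - 2 * pi * d * real m / n"
      "2 * pi * of_int (int k + d) * real m / n = 2 * pi * (int m) * k / n + 2 * pi * d * real m / n"
      by (simp_all add: algebra_simps diff_divide_distrib add_divide_distrib)
    have "cos (2 * pi * (int m) * k / n) * cos (2 * pi * d * real m / n)
      = (cos (2 * pi * of_int (int k + - d) * real m / n) + cos (2 * pi * of_int (int k + d) * real m / n)) / 2"
      by (simp only: angles cos_times_cos)
    then show "w (int k) * cos (2 * pi * (int m) * k / n) * cos (2 * pi * d * real m / n)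
      = w (int k) * (cos (2 * pi * of_int (int k + - d) * real m / n)
          + cos (2 * pi * of_int (int k + d) * real m / n)) / 2"
      by simp
  qed
  also have "\<dots> = (\<Sum>k<n. w (int k) * D (int k + - d) / 2 + w (int k) * D (int k + d) / 2)"
    unfolding D_def
    by (subst sum.swap) (simp add: sum_distrib_left sum.distrib distrib_left
        add_divide_distrib sum_divide_distrib)
  also have "\<dots> = (\<Sum>k<n. w (int k) * D (int k + - d)) / 2 + (\<Sum>k<n. w (int k) * D (int k + d)) / 2"
    by (simp add: sum.distrib sum_divide_distrib)
  also have "\<dots> = real n * w d"
    unfolding conv by (simp add: even)
  finally show ?thesis .
qed

text \<open>Diagonalization over the reals. Cosine and sine vectors of frequency \<open>m\<close>
  isolate one transform value; conversely, inversion writes the form as a sum of squares weighted by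
  transform values.\<close>

lemma circulant_form_nonneg_iff:
  fixes w :: "int \<Rightarrow> real"
  assumes n: "0 < n" and per: "\<And>k. w (k + int n) = w k" and even: "\<And>k. w (- k) = w k"
  shows "(\<forall>v. 0 \<le> (\<Sum>i<n. \<Sum>j<n. v i * v j * w (int i - int j)))
    \<longleftrightarrow> (\<forall>m. 0 \<le> cos_transform n w m)"
proof -
  have ang: "cos (2 * pi * of_int (m * (int i - int j)) / n)
     = cos (2 * pi * m * i / n) * cos (2 * pi * m * j / n)
       + sin (2 * pi * m * i / n) * sin (2 * pi * m * j / n)" for m :: int and i j :: nat
    by (simp add: cos_diff[symmetric] algebra_simps diff_divide_distrib)
  show ?thesis
  proof (intro iffI allI)
    fix m :: int
    assume pos: "\<forall>v. 0 \<le> (\<Sum>i<n. \<Sum>j<n. v i * v j * w (int i - int j))"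
    have row: "(\<Sum>j<n. w (int i - int j) * cos (2 * pi * of_int (m * (int i - int j)) / n))
        = cos_transform n w m" for i
    proof -
      have cper: "cos (2 * pi * (m * (k + int n)) / n) = cos (2 * pi * (m * k) / n)" for k
      proof -
        have "2 * pi * of_int (m * (k + int n)) / n = 2 * pi * of_int (m * k) / n + 2 * pi * of_int m"
          using n by (simp add: field_simps)
        then show ?thesis by (simp only: cos_add cos_int_2pin sin_int_2pin)
      qed
      have "(\<Sum>j<n. w (int i - int j) * cos (2 * pi * of_int (m * (int i - int j)) / n))
          = (\<Sum>j<n. w (int j + - int i) * cos (2 * pi * of_int (m * (int j + - int i)) / n))"
      proof (intro sum.cong refl arg_cong2[where f = "(*)"])
        fix j
        show "w (int i - int j) = w (int j + - int i)"
          using even[of "int j - int i"] by simp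
        have "cos (2 * pi * of_int (m * (int i - int j)) / n)
          = cos (- (2 * pi * of_int (m * (int j + - int i)) / n))"
          by (rule arg_cong[where f = cos])
            (simp only: minus_divide_left, simp add: algebra_simps)
        then show "cos (2 * pi * of_int (m * (int i - int j)) / n)
          = cos (2 * pi * of_int (m * (int j + - int i)) / n)"
          by (simp only: cos_minus)
      qed
      also have "\<dots> = (\<Sum>j<n. w (int j) * cos (2 * pi * of_int (m * int j) / n))"
        by (rule sum_periodic_shift) (simp only: per cper)
      finally show ?thesis by (simp add: cos_transform_def mult_ac)
    qed
    \<comment> \<open>The cosine and sine vectors are used together because their products add up to
      a function of \<open>i - j\<close>, so that every row contributes the same \<open>row\<close>
      value.\<close>
    have "0 \<le> (\<Sum>i<n. \<Sum>j<n. cos (2 * pi * m * i / n) * cos (2 * pi * m * j / n) * w (int i - int j))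
            + (\<Sum>i<n. \<Sum>j<n. sin (2 * pi * m * i / n) * sin (2 * pi * m * j / n) * w (int i - int j))"
      using pos by (intro add_nonneg_nonneg) auto
    also have "\<dots> = (\<Sum>i<n. \<Sum>j<n. w (int i - int j) * cos (2 * pi * of_int (m * (int i - int j)) / n))"
      unfolding ang by (simp add: sum.distrib algebra_simps)
    also have "\<dots> = real n * cos_transform n w m"
      unfolding row by simp
    finally show "0 \<le> cos_transform n w m"
      using n by (simp add: zero_le_mult_iff)
  next
    fix v :: "nat \<Rightarrow> real"
    assume pos: "\<forall>m. 0 \<le> cos_transform n w m"
    let ?C = "\<lambda>m. \<Sum>i<n. v i * cos (2 * pi * (int m) * i / n)"
    let ?S = "\<lambda>m. \<Sum>i<n. v i * sin (2 * pi * (int m) * i / n)"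
    have "real n * (\<Sum>i<n. \<Sum>j<n. v i * v j * w (int i - int j))
        = (\<Sum>i<n. \<Sum>j<n. v i * v j * (\<Sum>m<n. cos_transform n w (int m)
            * cos (2 * pi * (int i - int j) * real m / n)))"
      unfolding cos_transform_inversion[of n w, OF n per even]
      by (simp add: sum_distrib_left mult_ac)
    also have "\<dots> = (\<Sum>i<n. \<Sum>j<n. \<Sum>m<n. v i * v j * (cos_transform n w (int m)
            * cos (2 * pi * of_int (int m * (int i - int j)) / n)))"
      by (simp add: sum_distrib_left mult_ac)
    also have "\<dots> = (\<Sum>i<n. \<Sum>m<n. \<Sum>j<n. v i * v j * (cos_transform n w (int m)
            * cos (2 * pi * of_int (int m * (int i - int j)) / n)))"
      by (intro sum.cong refl sum.swap)
    also have "\<dots> = (\<Sum>m<n. \<Sum>i<n. \<Sum>j<n. v i * v j * (cos_transform n w (int m)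
            * cos (2 * pi * of_int (int m * (int i - int j)) / n)))"
      by (rule sum.swap)
    also have "\<dots> = (\<Sum>m<n. cos_transform n w (int m) * ((?C m)\<^sup>2 + (?S m)\<^sup>2))"
      unfolding ang power2_eq_square sum_product
      by (simp add: sum_distrib_left sum.distrib algebra_simps)
    also have "\<dots> \<ge> 0"
      using pos by (intro sum_nonneg mult_nonneg_nonneg) auto
    finally show "0 \<le> (\<Sum>i<n. \<Sum>j<n. v i * v j * w (int i - int j))"
      using n by (simp add: zero_le_mult_iff)
  qed
qed

section \<open>Rolle's theorem and the rule of signs for exponential sums\<close>

text \<open>Each new maximum of \<open>Z\<close> adds a critical point between it and the previous
  maximum. Keeping \<open>W\<close> below \<open>Max Z\<close> lets a further zero of
  \<open>g'\<close> at \<open>Max Z\<close> be counted separately.\<close>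

lemma Rolle_zeros:
  fixes g g' :: "real \<Rightarrow> real"
  assumes "finite Z" "Z \<noteq> {}" "\<And>z. z \<in> Z \<Longrightarrow> g z = 0"
    and der: "\<And>x. (g has_real_derivative g' x) (at x)"
  shows "\<exists>W. finite W \<and> Suc (card W) = card Z \<and> W \<subseteq> {..<Max Z} \<and> (\<forall>w\<in>W. g' w = 0)"
  using assms(1-3)
proof (induction Z rule: finite_linorder_max_induct)
  case empty
  then show ?case by simp
next
  case (insert b A)
  show ?case
  proof (cases "A = {}")
    case True
    then show ?thesis by (intro exI[of _ "{}"]) auto
  next
    case False
    with insert obtain W where W: "finite W" "Suc (card W) = card A" "W \<subseteq> {..<Max A}"
      "\<forall>w\<in>W. g' w = 0" by auto
    have mem: "Max A \<in> A" using insert False by simp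
    then have lt: "Max A < b" using insert by simp
    have "\<exists>z>Max A. z < b \<and> DERIV g z :> 0"
    proof (rule Rolle[OF lt])
      show "g (Max A) = g b" using insert.prems(2) mem by simp
      show "continuous_on {Max A..b} g"
        using der by (intro DERIV_continuous_on) (auto intro: has_field_derivative_at_within)
      show "g differentiable (at x)" for x
        using der real_differentiable_def by blast
    qed
    then obtain z where z: "Max A < z" "z < b" "DERIV g z :> 0" by blast
    then have "g' z = 0" using der DERIV_unique by blast
    moreover have "z \<notin> W" using W(3) z(1) by auto
    moreover have "Max (insert b A) = b" using lt insert(1) False by simp
    moreover have "b \<notin> A" using insert by blast
    ultimately show ?thesis
      using W z lt insert(1) by (intro exI[of _ "insert z W"]) fastforce
  qed
qed

text \<open>Exponents may coincide for different indices, as they do for \<open>k\<close> and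
  \<open>n - k\<close> in the application.\<close>

definition exp_sum :: "'k set \<Rightarrow> ('k \<Rightarrow> real) \<Rightarrow> ('k \<Rightarrow> real) \<Rightarrow> real \<Rightarrow> real" where
  "exp_sum K a x r = (\<Sum>k\<in>K. a k * exp (x k * r))"

lemma exp_sum_has_derivative:
  "(exp_sum K a x has_real_derivative exp_sum K (\<lambda>k. a k * x k) x r) (at r)"
  unfolding exp_sum_def
  by (auto intro!: derivative_eq_intros sum.cong)

lemma exp_sum_shift: "exp_sum K a (\<lambda>k. x k - t) r = exp (- t * r) * exp_sum K a x r"
  unfolding exp_sum_def sum_distrib_left
  by (intro sum.cong refl) (simp add: algebra_simps flip: exp_add)

text \<open>The factor \<open>exp (- t * r)\<close> leaves the zeros in place and shifts all
  exponents by \<open>- t\<close>. Differentiation then flips the sign of exactly the coefficients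
  with exponent below \<open>t\<close> and kills those at \<open>t\<close>.\<close>

lemma exp_sum_twisted_has_derivative:
  "((\<lambda>r. exp (- t * r) * exp_sum K a x r) has_real_derivative
     exp (- t * r) * exp_sum K (\<lambda>k. a k * (x k - t)) x r) (at r)"
  using exp_sum_has_derivative[of K a "\<lambda>k. x k - t" r]
  unfolding exp_sum_shift by (simp add: exp_sum_shift[abs_def])

text \<open>Descartes' rule of signs. The numbers \<open>t i\<close> separate the exponents at the sign changes of the
  coefficients; differentiating \<open>exp (- t i * r) * exp_sum K a x r\<close> removes the separator \<open>t i\<close>
  and, by Rolle, costs at most one zero.\<close>

lemma exp_sum_card_zeros_le:
  assumes "finite I" "finite K" "finite Z"
    and "\<And>k. k \<in> K \<Longrightarrow> 0 \<le> a k * (\<Prod>i\<in>I. x k - t i)"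
    and "l \<in> K" "0 < a l * (\<Prod>i\<in>I. x l - t i)"
    and "\<And>z. z \<in> Z \<Longrightarrow> exp_sum K a x z = 0"
  shows "card Z \<le> card I"
  using assms(1,3-)
proof (induction I arbitrary: a Z rule: finite_induct)
  case empty
  have pos: "exp_sum K a x r > 0" for r
    unfolding exp_sum_def using empty assms(2) by (intro sum_pos2[of K l]) auto
  have "z \<notin> Z" for z using empty.prems(5)[of z] pos[of z] by auto
  then have "Z = {}" by blast
  then show ?case by simp
next
  case (insert i I)
  show ?case
  proof (cases "Z = {}")
    case False
    obtain W where W: "finite W" "Suc (card W) = card Z"
      "\<forall>w\<in>W. exp (- t i * w) * exp_sum K (\<lambda>k. a k * (x k - t i)) x w = 0"
      using Rolle_zeros[OF insert.prems(1) False _ exp_sum_twisted_has_derivative[of "t i" K a x]]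
        insert.prems(5) by auto
    \<comment> \<open>The factor \<open>x k - t i\<close> moves from the product into the
      coefficient, so both sign hypotheses survive.\<close>
    have "card W \<le> card I"
      by (rule insert.IH[of W "\<lambda>k. a k * (x k - t i)"])
        (use W insert in \<open>auto simp: mult.assoc\<close>)
    then show ?thesis using W insert by simp
  qed simp
qed

text \<open>A double zero at \<open>Max Z\<close> counts twice: besides the
  \<open>card Z - 1\<close> Rolle zeros below it, the differentiated sum vanishes at
  \<open>Max Z\<close> itself, giving \<open>card Z\<close> zeros with one separator fewer.\<close>

lemma exp_sum_card_zeros_less:
  assumes "finite I" "finite K" "finite Z" "Z \<noteq> {}"
    and nn: "\<And>k. k \<in> K \<Longrightarrow> 0 \<le> a k * (\<Prod>i\<in>I. x k - t i)"
    and l: "l \<in> K" "0 < a l * (\<Prod>i\<in>I. x l - t i)"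
    and Z: "\<And>z. z \<in> Z \<Longrightarrow> exp_sum K a x z = 0"
    and dbl: "(exp_sum K a x has_real_derivative 0) (at (Max Z))"
  shows "card Z < card I"
proof -
  \<comment> \<open>As \<open>Z\<close> is nonempty, this bound guarantees a separator that can be
    removed.\<close>
  have "card Z \<le> card I"
    using exp_sum_card_zeros_le[OF assms(1-3) nn l Z] .
  then obtain i where i: "i \<in> I"
    using assms(3,4) by (cases "I = {}") auto
  let ?b = "\<lambda>k. a k * (x k - t i)"
  obtain W where W: "finite W" "Suc (card W) = card Z" "W \<subseteq> {..<Max Z}"
    "\<forall>w\<in>W. exp (- t i * w) * exp_sum K ?b x w = 0"
    using Rolle_zeros[OF assms(3,4) _ exp_sum_twisted_has_derivative[of "t i" K a x]] Z by auto
  have prod: "(\<Prod>j\<in>I. x k - t j) = (x k - t i) * (\<Prod>j\<in>I - {i}. x k - t j)" for k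
    using assms(1) i by (rule prod.remove)
  have "exp_sum K (\<lambda>k. a k * x k) x (Max Z) = 0"
    using dbl exp_sum_has_derivative DERIV_unique by blast
  moreover have "exp_sum K ?b x z = exp_sum K (\<lambda>k. a k * x k) x z - t i * exp_sum K a x z" for z
    unfolding exp_sum_def sum_distrib_left sum_subtractf[symmetric]
    by (intro sum.cong refl) (simp add: algebra_simps)
  ultimately have "exp_sum K ?b x (Max Z) = 0"
    using Z assms(3,4) by simp
  then have "card (insert (Max Z) W) \<le> card (I - {i})"
    using exp_sum_card_zeros_le[of "I - {i}" K "insert (Max Z) W" ?b x t l]
      assms(1,2) W nn l unfolding prod by (auto simp: mult.assoc)
  moreover have "Max Z \<notin> W" using W(3) by auto
  ultimately show ?thesis
    using W i assms(1) by (simp add: card_gt_0_iff)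
qed

text \<open>The cosine changes sign at each odd multiple of \<open>pi / 2\<close>, and so does one
  factor \<open>d i\<close>; the sign changes cancel. Beyond the last node all factors are
  nonpositive.\<close>

lemma cos_mult_prod_nonneg:
  fixes d :: "nat \<Rightarrow> real"
  assumes "0 \<le> \<phi>" "\<phi> \<le> (2 * real m + 1) * pi / 2"
    and "\<And>i. i < m \<Longrightarrow> \<phi> \<le> (2 * real i + 1) * pi / 2 \<Longrightarrow> 0 \<le> d i"
    and "\<And>i. i < m \<Longrightarrow> (2 * real i + 1) * pi / 2 \<le> \<phi> \<Longrightarrow> d i \<le> 0"
  shows "0 \<le> cos \<phi> * (\<Prod>i<m. d i)"
  using assms(2-)
proof (induction m)
  case 0
  then show ?case using assms(1) by (auto intro!: cos_ge_zero)
next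
  case (Suc m)
  show ?case
  proof (cases "\<phi> \<le> (2 * real m + 1) * pi / 2")
    case True
    then have "0 \<le> cos \<phi> * (\<Prod>i<m. d i)" using Suc by auto
    moreover have "0 \<le> d m" using Suc.prems(2) True by simp
    ultimately have "0 \<le> cos \<phi> * (\<Prod>i<m. d i) * d m" by (rule mult_nonneg_nonneg)
    then show ?thesis by (simp add: mult.assoc)
  next
    case False
    have neg: "d i \<le> 0" if "i < Suc m" for i
    proof -
      have "(2 * real i + 1) * pi \<le> (2 * real m + 1) * pi"
        using that by (intro mult_right_mono) auto
      then have "(2 * real i + 1) * pi / 2 \<le> \<phi>" using False by linarith
      then show ?thesis using that by (rule Suc.prems(3)[rotated])
    qed
    \<comment> \<open>Centres the interval between the last two nodes at 0, where the cosine is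
      nonnegative.\<close>
    define \<psi> where "\<psi> = \<phi> - real (Suc m) * pi"
    have "0 \<le> cos \<psi>"
      using False Suc.prems(1) by (intro cos_ge_zero) (auto simp: \<psi>_def field_simps)
    have "cos \<phi> = (- 1) ^ Suc m * cos \<psi>"
    proof -
      have "cos (\<psi> + real (Suc m) * pi) = (- 1) ^ Suc m * cos \<psi>"
        by (simp only: cos_add cos_npi sin_npi) simp
      then show ?thesis by (simp add: \<psi>_def)
    qed
    moreover have "(\<Prod>i<Suc m. d i) = (- 1) ^ Suc m * (\<Prod>i<Suc m. - d i)"
      using prod_uminus[of "\<lambda>i. - d i" "{..<Suc m}"] by simp
    ultimately have "cos \<phi> * (\<Prod>i<Suc m. d i)
        = ((- 1) ^ Suc m * (- 1) ^ Suc m) * (cos \<psi> * (\<Prod>i<Suc m. - d i))"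
      by (simp only: mult_ac)
    also have "\<dots> = cos \<psi> * (\<Prod>i<Suc m. - d i)"
      by (simp only: power_add[symmetric]) simp
    also have "\<dots> \<ge> 0"
      using neg \<open>0 \<le> cos \<psi>\<close> by (intro mult_nonneg_nonneg prod_nonneg) auto
    finally show ?thesis .
  qed
qed

section \<open>Transforms of even powers of the cosine\<close>

text \<open>On the transform side, multiplication by a squared cosine averages neighbouring
  frequencies with weights 1/4, 1/2, 1/4.\<close>

lemma cos_transform_even_power_rec:
  assumes "0 < n"
  shows "cos_transform n (\<lambda>k. cos (k * pi / n) ^ (2 * Suc s)) m =
    cos_transform n (\<lambda>k. cos (k * pi / n) ^ (2 * s)) m / 2 +
    (cos_transform n (\<lambda>k. cos (k * pi / n) ^ (2 * s)) (m - 1) +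
     cos_transform n (\<lambda>k. cos (k * pi / n) ^ (2 * s)) (m + 1)) / 4"
proof -
  have trig: "(cos \<theta>)\<^sup>2 * cos \<alpha> = cos \<alpha> / 2 + (cos (\<alpha> - 2 * \<theta>) + cos (\<alpha> + 2 * \<theta>)) / 4"
    for \<theta> \<alpha> :: real
    by (simp only: cos_add cos_diff cos_double_cos, simp add: field_simps)
  have "cos (of_int (int k) * pi / n) ^ (2 * Suc s) * cos (2 * pi * m * k / n) =
      cos (of_int (int k) * pi / n) ^ (2 * s) * cos (2 * pi * m * k / n) / 2 +
      (cos (of_int (int k) * pi / n) ^ (2 * s) * cos (2 * pi * of_int (m - 1) * k / n) +
       cos (of_int (int k) * pi / n) ^ (2 * s) * cos (2 * pi * of_int (m + 1) * k / n)) / 4" for k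
  proof -
    have eq: "2 * pi * of_int (m - 1) * k / n = 2 * pi * m * k / n - 2 * (of_int (int k) * pi / n)"
      "2 * pi * of_int (m + 1) * k / n = 2 * pi * m * k / n + 2 * (of_int (int k) * pi / n)"
      using assms by (simp_all add: field_simps)
    have "cos (of_int (int k) * pi / n) ^ (2 * Suc s) * cos (2 * pi * m * k / n) =
      cos (of_int (int k) * pi / n) ^ (2 * s) *
        ((cos (of_int (int k) * pi / n))\<^sup>2 * cos (2 * pi * m * k / n))"
      by (simp add: power2_eq_square)
    then show ?thesis unfolding trig eq by (simp add: algebra_simps)
  qed
  then show ?thesis
    unfolding cos_transform_def
    by (simp only: sum.distrib sum_divide_distrib[symmetric])
qed

text \<open>The transform of the constant 1 is nonnegative, and averaging preserves this.\<close>

lemma cos_transform_even_power_nonneg: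
  assumes "0 < n"
  shows "0 \<le> cos_transform n (\<lambda>k. cos (k * pi / n) ^ (2 * s)) m"
proof (induction s arbitrary: m)
  case 0
  then show ?case using sum_cos_multiples[OF assms, of m] by (simp add: cos_transform_def)
next
  case (Suc s)
  then show ?case unfolding cos_transform_even_power_rec[OF assms] by (auto intro!: add_nonneg_nonneg)
qed

text \<open>The transform of 1 lives on multiples of \<open>n\<close>, and each averaging step
  widens the support by one; the hypotheses keep \<open>m\<close> at distance more than
  \<open>s\<close> from 0 and \<open>n\<close>.\<close>

lemma cos_transform_even_power_eq_0:
  assumes "0 < n" "int s < m" "m + int s < int n"
  shows "cos_transform n (\<lambda>k. cos (k * pi / n) ^ (2 * s)) m = 0"
  using assms(2,3)
proof (induction s arbitrary: m)
  case 0
  then have "\<not> int n dvd m" by (auto dest: zdvd_imp_le)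
  then show ?case using sum_cos_multiples[OF assms(1), of m] by (simp add: cos_transform_def)
next
  case (Suc s)
  then show ?case unfolding cos_transform_even_power_rec[OF assms(1)] by simp
qed

text \<open>A zero would make \<open>2 * d\<close> an odd multiple of the odd number
  \<open>n\<close>.\<close>

lemma cos_odd_denominator_neq_0:
  assumes "odd n"
  shows "cos (of_int d * pi / real n) \<noteq> 0"
proof
  assume "cos (of_int d * pi / real n) = 0"
  then obtain i where i: "odd i" "of_int d * pi / real n = of_int i * (pi / 2)"
    by (auto simp: cos_zero_iff_int)
  have "0 < n" using assms by (rule odd_pos)
  with i have "real_of_int (2 * d) = real_of_int (i * int n)"
    by (simp add: field_simps)
  then have "2 * d = i * int n" by (simp only: of_int_eq_iff)
  moreover have "odd (i * int n)" using i assms by simp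
  ultimately show False by (metis dvd_triv_left)
qed

section \<open>Eigenvalues as exponential sums and the signs of their coefficients\<close>

definition abs_cos_power :: "nat \<Rightarrow> real \<Rightarrow> int \<Rightarrow> real" where
  "abs_cos_power n r k = \<bar>cos (k * pi / n)\<bar> powr r"

lemma abs_cos_power_periodic:
  assumes "0 < n"
  shows "abs_cos_power n r (k + int n) = abs_cos_power n r k"
proof -
  have "of_int (k + int n) * pi / n = of_int k * pi / n + pi"
    using assms by (simp add: field_simps)
  then show ?thesis by (simp add: abs_cos_power_def)
qed

lemma abs_cos_power_minus: "abs_cos_power n r (- k) = abs_cos_power n r k"
  by (simp add: abs_cos_power_def)

text \<open>Nonvanishing of the cosine matters for \<open>s = 0\<close>, where
  \<open>0 powr 0 = 0\<close> but \<open>0 ^ 0 = 1\<close>.\<close>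

lemma abs_cos_power_even:
  assumes "odd n"
  shows "abs_cos_power n (2 * real s) = (\<lambda>k. cos (k * pi / n) ^ (2 * s))"
proof
  fix k :: int
  have "\<bar>cos (k * pi / n)\<bar> powr (2 * real s) = \<bar>cos (k * pi / n)\<bar> ^ (2 * s)"
    using cos_odd_denominator_neq_0[OF assms, of k] powr_realpow[of "\<bar>cos (k * pi / n)\<bar>" "2 * s"]
    by simp
  then show "abs_cos_power n (2 * real s) k = cos (k * pi / n) ^ (2 * s)"
    by (simp add: abs_cos_power_def power_mult)
qed

definition log_abs_cos :: "nat \<Rightarrow> nat \<Rightarrow> real" where
  "log_abs_cos n k = ln \<bar>cos (k * pi / n)\<bar>"

lemma cos_transform_abs_cos_power:
  assumes "odd n"
  shows "cos_transform n (abs_cos_power n r) m =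
    exp_sum {..<n} (\<lambda>k. cos (2 * pi * m * k / n)) (log_abs_cos n) r"
proof -
  have "abs_cos_power n r (int k) = exp (log_abs_cos n k * r)" for k
    using cos_odd_denominator_neq_0[OF assms, of "int k"]
    by (simp add: abs_cos_power_def log_abs_cos_def powr_def mult.commute)
  then show ?thesis by (simp add: cos_transform_def exp_sum_def mult.commute)
qed

text \<open>Reflecting angles beyond \<open>pi / 2\<close> to \<open>pi - k * pi / n\<close>
  preserves the absolute cosine and the cosine of even multiples. Coefficient and exponent thus
  become functions of a single acute angle.\<close>

lemma folded_angle:
  fixes n k :: nat
  assumes "odd n" "k < n"
  obtains \<psi> where "0 \<le> \<psi>" "\<psi> < pi / 2" "\<bar>cos (k * pi / n)\<bar> = cos \<psi>"
    "\<And>m::nat. cos (2 * pi * m * k / n) = cos (2 * real m * \<psi>)" "\<psi> = 0 \<longleftrightarrow> k = 0"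
proof (cases "2 * k < n")
  case True
  have 1: "real k * pi / n < pi / 2"
  proof -
    have "real k / n < 1 / 2" using True by (simp add: field_simps)
    then have "real k / n * pi < 1 / 2 * pi" by (rule mult_strict_right_mono) simp
    then show ?thesis by simp
  qed
  then have "0 < cos (real k * pi / n)" by (intro cos_gt_zero_pi) (auto intro: less_le_trans[of _ 0])
  with 1 that[of "real k * pi / n"] assms show ?thesis by (auto simp: mult_ac)
next
  case False
  \<comment> \<open>Oddness of \<open>n\<close> excludes \<open>2 * k = n\<close>, the angle
    \<open>pi / 2\<close>.\<close>
  then have "n < 2 * k" using assms(1) by (cases "n = 2 * k") auto
  define \<psi> where "\<psi> = pi - real k * pi / n"
  have "1 / 2 < real k / n" "real k / n < 1"
    using \<open>n < 2 * k\<close> assms by (simp_all add: field_simps)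
  then have "1 / 2 * pi < real k / n * pi" "real k / n * pi < 1 * pi"
    by (auto intro!: mult_strict_right_mono simp del: times_divide_eq_left)
  then have psi: "0 < \<psi>" "\<psi> < pi / 2" by (simp_all add: \<psi>_def)
  then have "0 < cos \<psi>" by (intro cos_gt_zero_pi) auto
  moreover have "cos (real k * pi / n) = - cos \<psi>" by (simp add: \<psi>_def cos_diff)
  ultimately have "\<bar>cos (real k * pi / n)\<bar> = cos \<psi>" by simp
  moreover have "cos (2 * pi * m * k / n) = cos (2 * real m * \<psi>)" for m :: nat
  proof -
    have "2 * real m * \<psi> = 2 * pi * of_int (int m) - 2 * pi * m * k / n"
      by (simp add: \<psi>_def algebra_simps)
    then show ?thesis by (simp only: cos_diff cos_int_2pin sin_int_2pin)
  qed
  moreover have "k \<noteq> 0" using \<open>n < 2 * k\<close> by simp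
  ultimately show ?thesis using that[of \<psi>] psi by auto
qed

text \<open>The separators are the logarithms of the values of \<open>cos \<theta>\<close> at the zeros of \<open>cos (2 m \<theta>)\<close> in
  \<open>{0..pi/2}\<close>.\<close>

definition log_cos_node :: "nat \<Rightarrow> nat \<Rightarrow> real" where
  "log_cos_node m i = ln (cos ((2 * real i + 1) * pi / (4 * real m)))"

lemma log_cos_node_angle:
  assumes "i < m"
  shows "0 < (2 * real i + 1) * pi / (4 * real m)" "(2 * real i + 1) * pi / (4 * real m) < pi / 2"
proof -
  have "(2 * real i + 1) / (4 * real m) < 1 / 2"
    using assms by (simp add: field_simps)
  then have "(2 * real i + 1) / (4 * real m) * pi < 1 / 2 * pi"
    by (rule mult_strict_right_mono) simp
  then show "(2 * real i + 1) * pi / (4 * real m) < pi / 2" by simp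
  show "0 < (2 * real i + 1) * pi / (4 * real m)"
    using assms by (intro divide_pos_pos mult_pos_pos) auto
qed

text \<open>In the folded angle \<psi> the coefficient is \<open>cos (2 * m * \<psi>)\<close>. Since
  \<open>ln (cos \<psi>)\<close> decreases, each difference changes sign exactly at a zero of that
  coefficient.\<close>

lemma transform_coeff_separated:
  assumes "odd n" "k < n" "0 < m"
  shows "0 \<le> cos (2 * pi * m * k / n) * (\<Prod>i<m. log_abs_cos n k - log_cos_node m i)"
proof -
  obtain \<psi> where psi: "0 \<le> \<psi>" "\<psi> < pi / 2" "\<bar>cos (k * pi / n)\<bar> = cos \<psi>"
    "cos (2 * pi * m * k / n) = cos (2 * real m * \<psi>)"
    using folded_angle[OF assms(1,2)] by metis
  have mono: "cos \<beta> \<le> cos \<alpha> \<and> ln (cos \<beta>) \<le> ln (cos \<alpha>)"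
    if "0 \<le> \<alpha>" "\<alpha> \<le> \<beta>" "\<beta> < pi / 2" for \<alpha> \<beta> :: real
  proof -
    have "cos \<beta> \<le> cos \<alpha>" using that by (intro cos_monotone_0_pi_le) auto
    moreover have "0 < cos \<beta>" using that by (intro cos_gt_zero_pi) auto
    ultimately show ?thesis by simp
  qed
  have "0 \<le> cos (2 * real m * \<psi>) * (\<Prod>i<m. log_abs_cos n k - log_cos_node m i)"
  proof (rule cos_mult_prod_nonneg)
    show "0 \<le> 2 * real m * \<psi>" using psi by simp
    have "2 * real m * \<psi> \<le> 2 * real m * (pi / 2)" using psi by (intro mult_left_mono) auto
    then show "2 * real m * \<psi> \<le> (2 * real m + 1) * pi / 2"
      by (simp add: algebra_simps add_divide_distrib) (use pi_gt_zero in linarith)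
  next
    fix i assume i: "i < m" "2 * real m * \<psi> \<le> (2 * real i + 1) * pi / 2"
    then have "\<psi> \<le> (2 * real i + 1) * pi / (4 * real m)" using assms(3) by (simp add: field_simps)
    then show "0 \<le> log_abs_cos n k - log_cos_node m i"
      using mono[OF psi(1) _ log_cos_node_angle(2)[OF i(1)]] psi(3)
      by (simp add: log_abs_cos_def log_cos_node_def)
  next
    fix i assume i: "i < m" "(2 * real i + 1) * pi / 2 \<le> 2 * real m * \<psi>"
    then have "(2 * real i + 1) * pi / (4 * real m) \<le> \<psi>" using assms(3) by (simp add: field_simps)
    then show "log_abs_cos n k - log_cos_node m i \<le> 0"
      using mono[OF less_imp_le[OF log_cos_node_angle(1)[OF i(1)]] _ psi(2)] psi(3)
      by (simp add: log_abs_cos_def log_cos_node_def)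
  qed
  then show ?thesis using psi(4) by simp
qed

text \<open>Index 0 supplies the strict inequality required by the rule of signs: coefficient 1,
  exponent 0, and all separators negative.\<close>

lemma transform_coeff_separated_0:
  "0 < cos (2 * pi * m * (0::nat) / n) * (\<Prod>i<m. log_abs_cos n 0 - log_cos_node m i)"
proof -
  have "log_cos_node m i < 0" if "i < m" for i
  proof -
    note a = log_cos_node_angle[OF that]
    have "cos ((2 * real i + 1) * pi / (4 * real m)) < cos 0"
      using a pi_gt_zero by (intro cos_monotone_0_pi) linarith+
    moreover have "0 < cos ((2 * real i + 1) * pi / (4 * real m))"
      using a by (intro cos_gt_zero_pi) linarith+
    ultimately show ?thesis by (simp add: log_cos_node_def)
  qed
  then show ?thesis by (auto intro!: prod_pos simp: log_abs_cos_def)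
qed

lemma log_abs_cos_neg:
  assumes "odd n" "k < n" "k \<noteq> 0"
  shows "log_abs_cos n k < 0"
proof -
  obtain \<psi> where psi: "0 \<le> \<psi>" "\<psi> < pi / 2" "\<bar>cos (k * pi / n)\<bar> = cos \<psi>" "\<psi> \<noteq> 0"
    using folded_angle[OF assms(1,2)] assms(3) by metis
  then have "cos \<psi> < cos 0" by (intro cos_monotone_0_pi) auto
  moreover have "0 < cos \<psi>" using psi by (intro cos_gt_zero_pi) auto
  ultimately show ?thesis by (simp add: log_abs_cos_def psi(3))
qed

section \<open>Zeros and signs of a single eigenvalue\<close>

context
  fixes n m :: nat and F :: "real \<Rightarrow> real"
  assumes odd: "odd n" and m: "0 < m" "2 * m < n"
  defines "F \<equiv> (\<lambda>r. cos_transform n (abs_cos_power n r) (int m))"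
begin

lemma F_eq: "F = exp_sum {..<n} (\<lambda>k. cos (2 * pi * m * k / n)) (log_abs_cos n)"
  unfolding F_def cos_transform_abs_cos_power[OF odd] by simp

lemma F_even_zero: "s < m \<Longrightarrow> F (2 * real s) = 0"
  unfolding F_def abs_cos_power_even[OF odd]
  using m by (intro cos_transform_even_power_eq_0) auto

lemma F_card_zeros_le:
  assumes "finite Z" "\<And>z. z \<in> Z \<Longrightarrow> F z = 0"
  shows "card Z \<le> m"
proof -
  have "card Z \<le> card {..<m}"
    using assms m transform_coeff_separated[OF odd _ m(1)] transform_coeff_separated_0[of m n]
    unfolding F_eq
    by (intro exp_sum_card_zeros_le[where K = "{..<n}" and l = 0 and t = "log_cos_node m"
          and a = "\<lambda>k. cos (2 * pi * m * k / n)" and x = "log_abs_cos n"]) auto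
  then show ?thesis by simp
qed

lemma F_card_zeros_less:
  assumes "finite Z" "Z \<noteq> {}" "\<And>z. z \<in> Z \<Longrightarrow> F z = 0" "(F has_real_derivative 0) (at (Max Z))"
  shows "card Z < m"
proof -
  have "card Z < card {..<m}"
    using assms m transform_coeff_separated[OF odd _ m(1)] transform_coeff_separated_0[of m n]
    unfolding F_eq
    by (intro exp_sum_card_zeros_less[where K = "{..<n}" and l = 0 and t = "log_cos_node m"
          and a = "\<lambda>k. cos (2 * pi * m * k / n)" and x = "log_abs_cos n"]) auto
  then show ?thesis by simp
qed

lemma card_even_zeros: "card ((\<lambda>s. 2 * real s) ` {..<m}) = m"
  by (simp add: card_image inj_on_def)

text \<open>The \<open>m\<close> known even zeros already exhaust the bound.\<close>

lemma F_neq_0: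
  assumes "r \<notin> (\<lambda>s. 2 * real s) ` {..<m}"
  shows "F r \<noteq> 0"
proof
  assume "F r = 0"
  then have "card (insert r ((\<lambda>s. 2 * real s) ` {..<m})) \<le> m"
    using F_even_zero by (intro F_card_zeros_le) auto
  then show False using assms card_even_zeros by simp
qed

lemma F_isCont: "isCont F r"
  unfolding F_eq using exp_sum_has_derivative DERIV_isCont by blast

lemma F_no_sign_change:
  assumes "a \<le> b" "\<And>x. a \<le> x \<Longrightarrow> x \<le> b \<Longrightarrow> F x \<noteq> 0"
  shows "0 < F a \<longleftrightarrow> 0 < F b"
proof -
  have "\<not> (F a < 0 \<and> 0 < F b)"
    using IVT[of F a 0 b] assms F_isCont by force
  moreover have "\<not> (F b < 0 \<and> 0 < F a)"
    using IVT2[of F b 0 a] assms F_isCont by force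
  ultimately show ?thesis using assms by (metis linorder_less_linear order_refl)
qed

text \<open>Only the term \<open>k = 0\<close> has exponent 0; all others decay.\<close>

lemma F_tendsto: "(F \<longlongrightarrow> 1) at_top"
proof -
  have "((\<lambda>r. cos (2 * pi * m * k / n) * exp (log_abs_cos n k * r)) \<longlongrightarrow> (if k = 0 then 1 else 0)) at_top"
    if "k < n" for k
  proof (cases "k = 0")
    case True
    then show ?thesis by (simp add: log_abs_cos_def)
  next
    case False
    have "filterlim (\<lambda>r. log_abs_cos n k * r) at_bot at_top"
      using log_abs_cos_neg[OF odd that False]
      by (intro filterlim_tendsto_neg_mult_at_bot[OF tendsto_const]) (auto simp: filterlim_ident)
    then have "((\<lambda>r. exp (log_abs_cos n k * r)) \<longlongrightarrow> 0) at_top"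
      by (rule filterlim_compose[OF exp_at_bot])
    then show ?thesis using False by (auto intro: tendsto_mult_right_zero)
  qed
  then have "(F \<longlongrightarrow> (\<Sum>k<n. if k = 0 then 1 else 0)) at_top"
    unfolding F_eq exp_sum_def by (intro tendsto_sum) auto
  then show ?thesis using m by simp
qed

lemma F_pos:
  assumes "2 * (real m - 1) < r"
  shows "0 < F r"
proof -
  have "eventually (\<lambda>x. 0 < F x) at_top"
    using order_tendstoD(1)[OF F_tendsto, of 0] by simp
  then obtain R where R: "\<And>x. R \<le> x \<Longrightarrow> 0 < F x"
    by (auto simp: eventually_at_top_linorder)
  have "0 < F r \<longleftrightarrow> 0 < F (max r R)"
    using assms by (intro F_no_sign_change F_neq_0) auto
  then show ?thesis using R[of "max r R"] by simp
qed

text \<open>If \<open>F\<close> were positive on this interval, then, being positive also to the right of its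
  largest zero, it would have a double zero there.\<close>

lemma F_neg:
  assumes "2 \<le> m" "2 * (real m - 2) < r" "r < 2 * (real m - 1)"
  shows "F r < 0"
proof (rule ccontr)
  define z where "z = 2 * (real m - 1)"
  let ?Z = "(\<lambda>s. 2 * real s) ` {..<m}"
  have gap: "x \<notin> ?Z" if "2 * (real m - 2) < x" "x < z" for x
  proof
    assume "x \<in> ?Z"
    then obtain s where "s < m" "x = 2 * real s" by auto
    with that have "real m < real (s + 2)" "real (s + 1) < real m" by (auto simp: z_def)
    then have "m < s + 2" "s + 1 < m" by (simp_all only: of_nat_less_iff)
    then show False by linarith
  qed
  assume "\<not> F r < 0"
  then have "0 < F r" using F_neq_0[OF gap[of r]] assms by (simp add: z_def)
  have "0 < F x" if "r \<le> x" "x < z" for x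
    using F_no_sign_change[of r x] F_neq_0 gap that assms \<open>0 < F r\<close> by fastforce
  moreover have "F z = 0" using F_even_zero[of "m - 1"] m by (simp add: z_def of_nat_diff)
  moreover have "0 < F x" if "z < x" for x using F_pos that by (simp add: z_def)
  ultimately have min: "\<forall>y. \<bar>z - y\<bar> < z - r \<longrightarrow> F z \<le> F y"
    by (smt (verit))
  define D where "D = exp_sum {..<n} (\<lambda>k. cos (2 * pi * m * k / n) * log_abs_cos n k) (log_abs_cos n) z"
  have der: "(F has_real_derivative D) (at z)"
    unfolding F_eq D_def by (rule exp_sum_has_derivative)
  have "D = 0"
    by (rule DERIV_local_min[OF der _ min]) (use assms in \<open>simp add: z_def\<close>)
  have "Max ?Z = z"
  proof (rule Max_eqI)
    show "z \<in> ?Z" using m by (intro image_eqI[of _ _ "m - 1"]) (auto simp: z_def of_nat_diff)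
  qed (auto simp: z_def)
  \<comment> \<open>The double zero sits at the largest of the \<open>m\<close> known zeros, as the
    strict count requires.\<close>
  then have "card ?Z < m"
    using der \<open>D = 0\<close> m F_even_zero by (intro F_card_zeros_less) auto
  then show False using card_even_zeros by simp
qed

end

section \<open>Reduction to low frequencies and the final equivalence\<close>

lemma cos_transform_mod:
  assumes "0 < n"
  shows "cos_transform n w (m mod int n) = cos_transform n w m"
proof -
  have "cos (2 * pi * of_int m * k / n) = cos (2 * pi * of_int (m mod int n) * k / n)" for k :: nat
  proof -
    have "real_of_int m = of_int (m mod int n) + of_int (m div int n) * real n"
      by (metis mod_div_mult_eq of_int_add of_int_mult of_int_of_nat_eq)
    then have "2 * pi * of_int m * k / n =
        2 * pi * of_int (m mod int n) * k / n + 2 * pi * of_int (m div int n * int k)"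
      using assms by (simp add: field_simps)
    then show ?thesis by (simp only: cos_add cos_int_2pin sin_int_2pin)
  qed
  then show ?thesis by (simp add: cos_transform_def)
qed

lemma cos_transform_minus: "cos_transform n w (- m) = cos_transform n w m"
  by (simp add: cos_transform_def)

text \<open>Periodicity and evenness reduce to a frequency \<open>q\<close> with
  \<open>2 * q < n\<close>. For \<open>q > 0\<close>, parity gives
  \<open>2 * (q - 1) \<le> n - 3 < r\<close>, so \<open>F_pos\<close> applies.\<close>

lemma cos_transform_abs_cos_power_nonneg:
  assumes "odd n" "real n - 3 < r"
  shows "0 \<le> cos_transform n (abs_cos_power n r) m"
proof -
  have n: "0 < n" using assms(1) by (rule odd_pos)
  have half: "0 \<le> cos_transform n (abs_cos_power n r) (int q)" if "2 * q < n" for q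
  proof (cases "q = 0")
    case True
    then show ?thesis by (simp add: cos_transform_def abs_cos_power_def sum_nonneg)
  next
    case False
    have "2 * q \<le> n - 1" using that by simp
    then have "2 * real q \<le> real n - 1" using n by linarith
    then show ?thesis using F_pos[OF assms(1) _ that, of r] False assms(2) by simp
  qed
  define q where "q = nat (m mod int n)"
  have q: "int q = m mod int n" "q < n" using n by (auto simp: q_def nat_less_iff)
  have eq: "cos_transform n (abs_cos_power n r) m = cos_transform n (abs_cos_power n r) (int q)"
    using cos_transform_mod[OF n] q by simp
  show ?thesis
  proof (cases "2 * q < n")
    case True
    then show ?thesis using half eq by simp
  next
    case False
    then have "2 * (n - q) < n" using assms(1) q by (cases "n = 2 * q") auto
    have "int (n - q) mod int n = (- int q) mod int n"
      using q(2) by (simp add: of_nat_diff)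
    then have "cos_transform n (abs_cos_power n r) (int (n - q))
        = cos_transform n (abs_cos_power n r) (- int q)"
      using cos_transform_mod[OF n] by metis
    then show ?thesis
      using half[OF \<open>2 * (n - q) < n\<close>] eq by (simp add: cos_transform_minus)
  qed
qed

lemma positive_semidefinite_iff_transform:
  assumes n: "0 < n"
  shows "positive_semidefinite (hadamard_abs_power (cos_matrix n) r)
    \<longleftrightarrow> (\<forall>m. 0 \<le> cos_transform n (abs_cos_power n r) m)"
proof -
  let ?A = "hadamard_abs_power (cos_matrix n) r"
  have A: "?A = mat n n (\<lambda>(i, j). abs_cos_power n r (int i - int j))"
    by (rule eq_matI) (auto simp: hadamard_abs_power_def cos_matrix_def abs_cos_power_def)
  have sym: "?A\<^sup>T = ?A"
    unfolding A
  proof (rule eq_matI, goal_cases)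
    case (1 i j)
    then show ?case using abs_cos_power_minus[of n r "int i - int j"] by simp
  qed auto
  have form: "v \<bullet> (?A *\<^sub>v v) =
      (\<Sum>i<n. \<Sum>j<n. v $ i * v $ j * abs_cos_power n r (int i - int j))"
    if "v \<in> carrier_vec n" for v
    using that unfolding A
    by (auto simp: scalar_prod_def sum_distrib_left mult_ac atLeast0LessThan intro!: sum.cong)
  have "positive_semidefinite ?A \<longleftrightarrow> (\<forall>v\<in>carrier_vec n. 0 \<le> v \<bullet> (?A *\<^sub>v v))"
    using sym by (simp add: positive_semidefinite_def A)
  also have "\<dots> \<longleftrightarrow>
      (\<forall>v. 0 \<le> (\<Sum>i<n. \<Sum>j<n. v i * v j * abs_cos_power n r (int i - int j)))"
  proof (intro iffI allI ballI)
    fix v :: "nat \<Rightarrow> real"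
    assume "\<forall>v\<in>carrier_vec n. 0 \<le> v \<bullet> (?A *\<^sub>v v)"
    then have "0 \<le> vec n v \<bullet> (?A *\<^sub>v vec n v)" by simp
    then show "0 \<le> (\<Sum>i<n. \<Sum>j<n. v i * v j * abs_cos_power n r (int i - int j))"
      by (subst (asm) form) auto
  qed (simp add: form)
  also have "\<dots> \<longleftrightarrow> (\<forall>m. 0 \<le> cos_transform n (abs_cos_power n r) m)"
    by (intro circulant_form_nonneg_iff abs_cos_power_periodic abs_cos_power_minus n)
  finally show ?thesis .
qed

theorem theorem1p2:
  fixes n :: nat and r :: real
  assumes "3 \<le> n" and "odd n" and "0 \<le> r"
  shows "positive_semidefinite (hadamard_abs_power (cos_matrix n) r) \<longleftrightarrow>
           (\<exists>m::nat. even m \<and> r = real m) \<or> real n - 3 < r"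
proof -
  have n: "0 < n" using assms(1) by simp
  have "(\<forall>m. 0 \<le> cos_transform n (abs_cos_power n r) m) \<longleftrightarrow>
      (\<exists>m::nat. even m \<and> r = real m) \<or> real n - 3 < r"
  proof (intro iffI allI)
    assume nonneg: "\<forall>m. 0 \<le> cos_transform n (abs_cos_power n r) m"
    show "(\<exists>m::nat. even m \<and> r = real m) \<or> real n - 3 < r"
    proof (rule ccontr)
      assume contra: "\<not> ?thesis"
      \<comment> \<open>Frequency \<open>s + 2\<close> is the one whose interval of negativity, from
        \<open>2 * s\<close> to \<open>2 * s + 2\<close>, contains \<open>r\<close>.\<close>
      define s where "s = nat \<lfloor>r / 2\<rfloor>"
      have s: "2 * real s \<le> r" "r < 2 * real s + 2"
        using assms(3) unfolding s_def by linarith+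
      have "r \<noteq> real (2 * s)" using contra by (metis dvd_triv_left)
      with s have s': "2 * real s < r" by simp
      moreover have "r \<le> real n - 3" using contra by simp
      ultimately have "2 * s + 3 < n" by linarith
      \<comment> \<open>Parity of \<open>n\<close> provides the last unit needed for
        \<open>2 * (s + 2) < n\<close>.\<close>
      moreover have "n \<noteq> 2 * s + 4" using assms(2) by auto
      ultimately have "2 * (s + 2) < n" by simp
      then have "cos_transform n (abs_cos_power n r) (int (s + 2)) < 0"
        using s s' by (intro F_neg assms(2)) auto
      with nonneg show False by (metis not_less)
    qed
  next
    fix m
    assume "(\<exists>m::nat. even m \<and> r = real m) \<or> real n - 3 < r"
    then show "0 \<le> cos_transform n (abs_cos_power n r) m"
    proof
      assume "\<exists>m::nat. even m \<and> r = real m"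
      then obtain s :: nat where "r = 2 * real s" by (auto elim!: evenE)
      then show ?thesis
        using cos_transform_even_power_nonneg[OF n] abs_cos_power_even[OF assms(2)] by simp
    qed (rule cos_transform_abs_cos_power_nonneg[OF assms(2)])
  qed
  then show ?thesis using positive_semidefinite_iff_transform[OF n] by simp
qed

end
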